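(* Let $\eta_1,\eta_2,\dots$ be iid with $\Pr(\eta_1\le x)=e^x$, $x\le0$. Let $j_i=j_i(n)\in\mathbb{N}$, $i=1,2,\dots$, be integer sequences with $j_1(n)<j_2(n)<\cdots$ and $j_i(n)/n\to\lambda_i>0$ as $n\to\infty$, where $0<\lambda_1<\lambda_2<\cdots$. Then: (i) for every $s\ge2$ and all $y_1,\dots,y_{s-1}>0$, \[ \lim_{n\to\infty}\Pr\left(\eta_{j_{i+1}}-\eta_{j_i}\le \frac{y_i}{n},\ 1\le i\le s-1\ \Big|\ \eta_{j_1},\dots,\eta_{j_s}\text{ are records}\right)=\prod_{i=1}^{s-1}\left(1-e^{-\lambda_iy_i}\right); \] (ii) writing $j=j_1$, $k=j_2$ and $\beta_i=\lambda_i/(\lambda_2-\lambda_1)$, $i=1,2$, for all $x\le0$ and $y>0$, \[ \lim_{n\to\infty}\Pr\left(\eta_j\le\frac{x}{n},\ \eta_k-\eta_j\le\frac{y}{n}\ \Big|\ \eta_j\text{ and }\eta_k\text{ are records}\right)=Q_{\lambda_1,\lambda_2}(x,y), \] where \[ Q_{\lambda_1,\lambda_2}(x,y)=\begin{cases} \beta_1\left(e^{(\lambda_2-\lambda_1)y}-1\right)e^{\lambda_2x}, & \text{if } |x|\ge y,\\ \beta_2e^{\lambda_1x}-\beta_1e^{\lambda_2x}-e^{-\lambda_1y}, & \text{if } |x|<y. \end{cases} \]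
   Context: $\eta_m$ is a record if $\eta_m>\max(\eta_1,\dots,\eta_{m-1})$; $\eta_1$ is always a record. *)

theory Defs
  imports "HOL-Probability.Probability"
begin

definition is_record :: "(nat \<Rightarrow> 'a \<Rightarrow> real) \<Rightarrow> nat \<Rightarrow> 'a \<Rightarrow> bool" where
  "is_record eta m \<omega> \<longleftrightarrow> (\<forall>i\<in>{1..<m}. eta i \<omega> < eta m \<omega>)"

definition cond_prob_el :: "'a measure \<Rightarrow> 'a set \<Rightarrow> 'a set \<Rightarrow> real" where
  "cond_prob_el M A B = measure M (A \<inter> B) / measure M B"

definition Qfun :: "real \<Rightarrow> real \<Rightarrow> real \<Rightarrow> real \<Rightarrow> real" where
  "Qfun l1 l2 x y =
     (let b1 = l1 / (l2 - l1); b2 = l2 / (l2 - l1) in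
      if \<bar>x\<bar> \<ge> y then b1 * (exp ((l2 - l1) * y) - 1) * exp (l2 * x)
      else b2 * exp (l1 * x) - b1 * exp (l2 * x) - exp (- l1 * y))"

end

theory Submission
  imports Defs
begin

text \<open>
  Both limits come from exact formulas at finite \<open>n\<close>. Conditioning on the value \<open>w\<close> of the last
  record, an event \<open>A\<close> about the records up to time \<open>j\<close> satisfying
  \<open>P(A, eta_j \<le> v) = C exp (j v)\<close> for all \<open>v \<le> 0\<close> gains a factor
  \<open>exp ((m - j) w)\<close>, and integrating over \<open>w \<le> v\<close> gives an event at the next record time \<open>m\<close> of
  the same form. Bounding the gap to the next record by \<open>y\<close> multiplies \<open>C\<close> by
  \<open>1 - exp (- j y)\<close>, so given the records the gaps are independent exponential variables. In the same
  way the conditional probability in (ii) equals \<open>Qfun\<close> at \<open>j / n\<close> and \<open>k / n\<close>.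
\<close>

section \<open>Exponential integrals over left half-lines\<close>

lemma nn_integral_exp_atMost:
  fixes a v :: real
  assumes "a > 0"
  shows "(\<integral>\<^sup>+w. ennreal (exp (a * w)) * indicator {..v} w \<partial>lborel) = ennreal (exp (a * v) / a)"
proof -
  have "(\<integral>\<^sup>+w. ennreal (exp (a * w)) * indicator {..v} w \<partial>lborel)
      = (\<integral>\<^sup>+w. ennreal (exp (- (a * w))) * indicator {- v..} w \<partial>lborel)"
    \<comment> \<open>Reflection at the origin produces a right half-line, the form that
      \<open>nn_integral_FTC_atLeast\<close> handles.\<close>
    by (subst nn_integral_real_affine[where c = "- 1" and t = 0])
       (auto simp: indicator_def minus_le_iff intro!: nn_integral_cong)
  also have "\<dots> = ennreal (0 - (- exp (- (a * - v)) / a))"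
  proof (rule nn_integral_FTC_atLeast)
    show "((\<lambda>w. - exp (- (a * w)) / a) \<longlongrightarrow> 0) at_top"
    proof (rule tendsto_eq_intros)
      show "((\<lambda>w. - exp (- (a * w))) \<longlongrightarrow> - 0) at_top"
        using assms by (intro tendsto_minus filterlim_compose[OF exp_at_bot]
            filterlim_compose[OF filterlim_uminus_at_bot_at_top] filterlim_tendsto_pos_mult_at_top[of _ a] filterlim_ident) auto
    qed (use assms in auto)
  qed (use assms in \<open>auto intro!: derivative_eq_intros\<close>)
  finally show ?thesis by simp
qed

lemma has_bochner_integral_exp_atMost:
  fixes a v :: real
  assumes "a > 0"
  shows "has_bochner_integral lborel (\<lambda>w. indicator {..v} w *\<^sub>R exp (a * w)) (exp (a * v) / a)"
proof (rule has_bochner_integral_nn_integral)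
  have "(\<integral>\<^sup>+w. ennreal (indicator {..v} w *\<^sub>R exp (a * w)) \<partial>lborel)
      = (\<integral>\<^sup>+w. ennreal (exp (a * w)) * indicator {..v} w \<partial>lborel)"
    by (intro nn_integral_cong) (auto simp: indicator_def)
  also have "\<dots> = ennreal (exp (a * v) / a)"
    by (rule nn_integral_exp_atMost[OF assms])
  finally show "(\<integral>\<^sup>+w. ennreal (indicator {..v} w *\<^sub>R exp (a * w)) \<partial>lborel) = ennreal (exp (a * v) / a)" .
qed (use assms in auto)

lemma
  fixes a v :: real
  assumes "a > 0"
  shows set_integrable_exp_atMost: "set_integrable lborel {..v} (\<lambda>w. exp (a * w))"
    and set_integral_exp_atMost: "(LBINT w:{..v}. exp (a * w)) = exp (a * v) / a"
  using has_bochner_integral_exp_atMost[OF assms]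
  by (auto simp: set_integrable_def set_lebesgue_integral_def has_bochner_integral_iff)

text \<open>The minimum arises from two simultaneous upper bounds on an earlier record: a fixed one
  and the value \<open>w\<close> of a later record. Splitting at \<open>z\<close> leaves pure
  exponentials, of rate \<open>p + q\<close> below \<open>z\<close> and of rate \<open>q\<close>
  with a constant factor above.\<close>

lemma
  fixes p q z :: real
  assumes "0 < p" "0 < q" "z \<le> 0"
  shows set_integrable_exp_min: "set_integrable lborel {..0} (\<lambda>w. exp (p * min w z) * exp (q * w))"
    and set_integral_exp_min: "(LBINT w:{..0}. exp (p * min w z) * exp (q * w))
      = exp ((p + q) * z) / (p + q) + (exp (p * z) - exp ((p + q) * z)) / q"
proof -
  let ?f = "\<lambda>w. exp (p * min w z) * exp (q * w)"
  have un: "{..0} = {..z} \<union> {z<..0}" "{..z} \<inter> {z<..0} = {}" using assms by auto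
  have low: "set_integrable lborel {..z} ?f \<longleftrightarrow> set_integrable lborel {..z} (\<lambda>w. exp ((p + q) * w))"
    "(LBINT w:{..z}. ?f w) = (LBINT w:{..z}. exp ((p + q) * w))"
    by (intro set_integrable_cong set_lebesgue_integral_cong allI impI;
        simp add: min_def distrib_right exp_add)+
  have high: "set_integrable lborel {z<..0} ?f \<longleftrightarrow> set_integrable lborel {z<..0} (\<lambda>w. exp (p * z) * exp (q * w))"
    "(LBINT w:{z<..0}. ?f w) = (LBINT w:{z<..0}. exp (p * z) * exp (q * w))"
    by (intro set_integrable_cong set_lebesgue_integral_cong allI impI; simp add: min_def)+
  have int: "set_integrable lborel {..0} (\<lambda>w. exp (q * w))"
    using assms by (intro set_integrable_exp_atMost)
  have ints: "set_integrable lborel {..z} (\<lambda>w. exp (q * w))" "set_integrable lborel {z<..0} (\<lambda>w. exp (q * w))"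
    using assms by (auto intro: set_integrable_subset[OF int])
  have "(LBINT w:{..0}. exp (q * w)) = (LBINT w:{..z}. exp (q * w)) + (LBINT w:{z<..0}. exp (q * w))"
    unfolding un(1) by (rule set_integral_Un[OF un(2) ints])
  then have diff: "(LBINT w:{z<..0}. exp (q * w)) = (1 - exp (q * z)) / q"
    using assms by (simp add: set_integral_exp_atMost diff_divide_distrib)
  have L: "set_integrable lborel {..z} ?f"
    unfolding low by (rule set_integrable_exp_atMost) (use assms in simp)
  have H: "set_integrable lborel {z<..0} ?f"
    unfolding high by (rule set_integrable_mult_right) (rule ints)
  show "set_integrable lborel {..0} ?f"
    unfolding un(1) using L H by (rule set_integrable_Un) auto
  have "(LBINT w:{..0}. ?f w) = (LBINT w:{..z}. ?f w) + (LBINT w:{z<..0}. ?f w)"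
    unfolding un(1) by (rule set_integral_Un[OF un(2) L H])
  moreover have "exp ((p + q) * z) = exp (p * z) * exp (q * z)"
    by (simp add: distrib_right exp_add)
  ultimately show "(LBINT w:{..0}. ?f w) = exp ((p + q) * z) / (p + q) + (exp (p * z) - exp ((p + q) * z)) / q"
    using assms unfolding low high by (simp add: set_integral_exp_atMost diff right_diff_distrib)
qed

section \<open>The limit function \<open>Qfun\<close>\<close>

text \<open>Each bracket is the value of \<open>set_integral_exp_min\<close> for the rates
  \<open>p\<close> and \<open>q - p\<close>, once with threshold \<open>x\<close> and once with
  \<open>z\<close>; this is the shape in which \<open>prob_two_records\<close> produces the answer.
  The two cases of \<open>Qfun\<close> tell whether \<open>z\<close> is \<open>x + y\<close> or is
  cut off at 0.\<close>

lemma Qfun_conv_min: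
  fixes p q x y :: real
  assumes pq: "0 < p" "p < q" and x: "x \<le> 0"
  defines "z \<equiv> min (x + y) 0"
  shows "Qfun p q x y = q * ((exp (q * x) / q + (exp (p * x) - exp (q * x)) / (q - p))
      - exp (- p * y) * (exp (q * z) / q + (exp (p * z) - exp (q * z)) / (q - p)))"
proof (cases "\<bar>x\<bar> \<ge> y")
  case True
  define a b c where "a = exp (p * x)" and "b = exp (q * x)" and "c = exp ((q - p) * y)"
  have z: "z = x + y" using True x by (simp add: z_def)
  have "exp (- p * y) * exp (q * z) = b * c" "exp (- p * y) * exp (p * z) = a"
    by (simp_all add: a_def b_def c_def z exp_add[symmetric] algebra_simps)
  then have "exp (- p * y) * (exp (q * z) / q + (exp (p * z) - exp (q * z)) / (q - p)) = b * c / q + (a - b * c) / (q - p)"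
    by (simp only: distrib_left right_diff_distrib times_divide_eq_right)
  \<comment> \<open>The terms in \<open>a\<close> cancel. After multiplication by \<open>q\<close>,
    the partial fraction in the next claim becomes the factor \<open>b1\<close> of
    \<open>Qfun\<close>.\<close>
  moreover have "b / q + (a - b) / (q - p) - (b * c / q + (a - b * c) / (q - p)) = b * (c - 1) * (1 / (q - p) - 1 / q)"
    by (simp add: algebra_simps diff_divide_distrib add_divide_distrib)
  moreover have "1 / (q - p) - 1 / q = p / (q - p) / q"
    using pq by (simp add: field_simps)
  ultimately show ?thesis
    using True pq by (simp add: Qfun_def a_def[symmetric] b_def[symmetric] c_def[symmetric])
next
  case False
  then have z: "z = 0" using x by (simp add: z_def)
  have "q / (q - p) = 1 + p / (q - p)"
    using pq by (simp add: field_simps)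
  moreover have "q * (exp (q * x) / q + (exp (p * x) - exp (q * x)) / (q - p) - exp (- p * y) / q)
      = exp (q * x) + q / (q - p) * (exp (p * x) - exp (q * x)) - exp (- p * y)"
    using pq by (simp add: right_diff_distrib distrib_left diff_divide_distrib)
  ultimately show ?thesis
    using False z by (simp add: Qfun_def algebra_simps)
qed

text \<open>Apart from the ratios \<open>b1\<close> and \<open>b2\<close>, only products of a rate
  with \<open>x\<close> or \<open>y\<close> occur, so the scaling by \<open>1 / n\<close> can be
  moved from the arguments to the indices, where it yields convergent parameters.\<close>

lemma Qfun_scale:
  assumes "c > 0"
  shows "Qfun p q (x / c) (y / c) = Qfun (p / c) (q / c) x y"
proof -
  have "\<bar>x / c\<bar> \<ge> y / c \<longleftrightarrow> \<bar>x\<bar> \<ge> y"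
    using assms by (simp add: divide_le_cancel)
  then show ?thesis
    using assms unfolding Qfun_def diff_divide_distrib[symmetric] Let_def by simp
qed

text \<open>The case distinction involves \<open>x\<close> and \<open>y\<close> only, so it is the
  same along the whole filter, and each branch is continuous in the rates away from equal
  rates.\<close>

lemma tendsto_Qfun:
  assumes "(a \<longlongrightarrow> l1) F" "(b \<longlongrightarrow> l2) F" "l1 \<noteq> l2"
  shows "((\<lambda>n. Qfun (a n) (b n) x y) \<longlongrightarrow> Qfun l1 l2 x y) F"
  unfolding Qfun_def Let_def using assms by (cases "\<bar>x\<bar> \<ge> y"; simp only: if_True if_False; intro tendsto_intros; simp)

section \<open>Conditioning on an independent variable\<close>

text \<open>Fubini for the joint law. The map \<open>g\<close> is there because independence of
  index blocks speaks of tuples, while the value to condition on is the single entry of a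
  one-element tuple. The measurability claim is needed later to integrate against a density.\<close>

lemma (in prob_space) prob_indep_pair:
  assumes indep: "indep_var S X T Y" and g[measurable]: "g \<in> T \<rightarrow>\<^sub>M N" and E[measurable]: "E \<in> sets (S \<Otimes>\<^sub>M N)"
  shows "prob {\<omega> \<in> space M. (X \<omega>, g (Y \<omega>)) \<in> E}
      = (\<integral>y. prob {\<omega> \<in> space M. (X \<omega>, y) \<in> E} \<partial>distr M N (\<lambda>\<omega>. g (Y \<omega>)))"
    and "(\<lambda>y. prob {\<omega> \<in> space M. (X \<omega>, y) \<in> E}) \<in> borel_measurable N"
proof -
  have X[measurable]: "random_variable S X" and Y[measurable]: "random_variable T Y"
    using indep by (auto dest: indep_var_rv1 indep_var_rv2)
  let ?Z = "\<lambda>\<omega>. g (Y \<omega>)"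
  interpret X: prob_space "distr M S X" by (rule prob_space_distr) fact
  interpret Z: prob_space "distr M N ?Z" by (rule prob_space_distr) measurable
  interpret XZ: pair_prob_space "distr M S X" "distr M N ?Z" ..
  \<comment> \<open>The joint law of \<open>X\<close> and \<open>g\<close> of \<open>Y\<close> is a
    product law: it is the image of the product law of \<open>X\<close> and \<open>Y\<close> under
    \<open>g\<close> in the second component.\<close>
  have "distr M S X \<Otimes>\<^sub>M distr M N ?Z = distr (distr M S X) S (\<lambda>x. x) \<Otimes>\<^sub>M distr (distr M T Y) N g"
    by (simp add: distr_distr comp_def)
  also have "\<dots> = distr (distr M S X \<Otimes>\<^sub>M distr M T Y) (S \<Otimes>\<^sub>M N) (\<lambda>(x, y). (x, g y))"
    using Z.sigma_finite_measure_axioms by (intro pair_measure_distr) (auto simp: distr_distr comp_def)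
  also have "distr M S X \<Otimes>\<^sub>M distr M T Y = distr M (S \<Otimes>\<^sub>M T) (\<lambda>\<omega>. (X \<omega>, Y \<omega>))"
    using indep by (simp add: indep_var_distribution_eq)
  also have "distr \<dots> (S \<Otimes>\<^sub>M N) (\<lambda>(x, y). (x, g y)) = distr M (S \<Otimes>\<^sub>M N) (\<lambda>\<omega>. (X \<omega>, ?Z \<omega>))"
    by (subst distr_distr) (auto simp: comp_def)
  finally have joint: "distr M S X \<Otimes>\<^sub>M distr M N ?Z = distr M (S \<Otimes>\<^sub>M N) (\<lambda>\<omega>. (X \<omega>, ?Z \<omega>))" .
  have slice: "emeasure (distr M S X) ((\<lambda>x. (x, y)) -` E) = ennreal (prob {\<omega> \<in> space M. (X \<omega>, y) \<in> E})"
    if "y \<in> space N" for y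
  proof -
    have "(\<lambda>x. (x, y)) -` E \<inter> space S \<in> sets S"
      using that by measurable
    moreover have "(\<lambda>x. (x, y)) -` E \<inter> space S = (\<lambda>x. (x, y)) -` E"
      using sets.sets_into_space[OF E] by (auto simp: space_pair_measure)
    ultimately show ?thesis
      by (auto simp: emeasure_distr emeasure_eq_measure intro!: arg_cong[where f = prob])
  qed
  have "(\<lambda>y. emeasure (distr M S X) ((\<lambda>x. (x, y)) -` E)) \<in> borel_measurable N"
    using XZ.measurable_emeasure_Pair2[of E] by simp
  then have "(\<lambda>y. ennreal (prob {\<omega> \<in> space M. (X \<omega>, y) \<in> E})) \<in> borel_measurable N"
    by (subst (asm) measurable_cong) (auto simp: slice)
  then have "(\<lambda>y. enn2real (ennreal (prob {\<omega> \<in> space M. (X \<omega>, y) \<in> E}))) \<in> borel_measurable N"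
    by measurable
  then show meas: "(\<lambda>y. prob {\<omega> \<in> space M. (X \<omega>, y) \<in> E}) \<in> borel_measurable N"
    by simp
  have "ennreal (prob {\<omega> \<in> space M. (X \<omega>, ?Z \<omega>) \<in> E}) = emeasure (distr M (S \<Otimes>\<^sub>M N) (\<lambda>\<omega>. (X \<omega>, ?Z \<omega>))) E"
    by (auto simp: emeasure_distr emeasure_eq_measure intro!: arg_cong[where f = prob])
  also have "\<dots> = emeasure (distr M S X \<Otimes>\<^sub>M distr M N ?Z) E"
    by (simp only: joint)
  also have "\<dots> = (\<integral>\<^sup>+y. emeasure (distr M S X) ((\<lambda>x. (x, y)) -` E) \<partial>distr M N ?Z)"
    by (rule XZ.emeasure_pair_measure_alt2) simp
  also have "\<dots> = (\<integral>\<^sup>+y. ennreal (prob {\<omega> \<in> space M. (X \<omega>, y) \<in> E}) \<partial>distr M N ?Z)"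
    by (intro nn_integral_cong) (auto simp: slice)
  finally have "(\<integral>\<^sup>+y. ennreal (prob {\<omega> \<in> space M. (X \<omega>, y) \<in> E}) \<partial>distr M N ?Z)
      = ennreal (prob {\<omega> \<in> space M. (X \<omega>, ?Z \<omega>) \<in> E})" ..
  then show "prob {\<omega> \<in> space M. (X \<omega>, ?Z \<omega>) \<in> E} = (\<integral>y. prob {\<omega> \<in> space M. (X \<omega>, y) \<in> E} \<partial>distr M N ?Z)"
    using meas by (subst integral_eq_nn_integral) auto
qed

section \<open>Independent variables with the negative exponential law\<close>

locale neg_exponential_sequence = prob_space +
  fixes eta :: "nat \<Rightarrow> 'a \<Rightarrow> real"
  assumes indep: "indep_vars (\<lambda>_. borel) eta {1..}"
    and prob_le: "\<And>i x. i \<ge> 1 \<Longrightarrow> x \<le> 0 \<Longrightarrow> prob {\<omega> \<in> space M. eta i \<omega> \<le> x} = exp x"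
begin

lemma eta_measurable: "i \<ge> 1 \<Longrightarrow> eta i \<in> borel_measurable M"
  using indep by (auto simp: indep_vars_def)

text \<open>The distribution function is prescribed on nonpositive arguments only, but its value at
  0 is 1, so monotonicity fixes it on the rest of the line.\<close>

lemma distr_eta:
  assumes i: "i \<ge> 1"
  shows "distr M borel (eta i) = density lborel (\<lambda>w. ennreal (exp w * indicator {..0} w))" (is "_ = ?N")
proof (rule cdf_unique)
  note [measurable] = eta_measurable[OF i]
  show "real_distribution (distr M borel (eta i))"
    by (rule real_distribution_distr) measurable
  have N: "emeasure ?N {..x} = ennreal (exp (min x 0))" for x
  proof -
    have "emeasure ?N {..x} = (\<integral>\<^sup>+w. ennreal (exp (1 * w)) * indicator {..min x 0} w \<partial>lborel)"
      by (subst emeasure_density) (auto intro!: nn_integral_cong simp: indicator_def)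
    then show ?thesis by (simp only: nn_integral_exp_atMost) simp
  qed
  have "emeasure ?N UNIV = emeasure ?N {..0}"
    by (auto simp: emeasure_density intro!: nn_integral_cong split: split_indicator)
  then have "emeasure ?N UNIV = 1" using N[of 0] by simp
  then have "prob_space ?N" by (intro prob_spaceI) simp
  then show "real_distribution ?N"
    by (simp add: real_distribution_def real_distribution_axioms_def)
  have "prob {\<omega> \<in> space M. eta i \<omega> \<le> x} = exp (min x 0)" for x
  proof (cases "x \<le> 0")
    case False
    have "prob {\<omega> \<in> space M. eta i \<omega> \<le> 0} \<le> prob {\<omega> \<in> space M. eta i \<omega> \<le> x}"
      using False by (intro finite_measure_mono) auto
    with False show ?thesis using prob_le[OF i, of 0] by (simp add: antisym)
  qed (use prob_le[OF i, of x] in simp)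
  moreover have "eta i -` {..x} \<inter> space M = {\<omega> \<in> space M. eta i \<omega> \<le> x}" for x by auto
  ultimately show "cdf (distr M borel (eta i)) = cdf ?N"
    using N by (auto simp: cdf_def measure_distr fun_eq_iff measure_def[of ?N])
qed

lemma AE_eta_neq:
  assumes i: "i \<ge> 1"
  shows "AE \<omega> in M. eta i \<omega> \<noteq> x"
proof -
  note [measurable] = eta_measurable[OF i]
  have "AE w in distr M borel (eta i). w \<noteq> x"
    unfolding distr_eta[OF i] using AE_lborel_singleton[of x] by (subst AE_density) auto
  then show ?thesis by (subst (asm) AE_distr_iff) auto
qed

text \<open>Records are defined by strict comparison, whereas the exact formulas use weak bounds; as
  the law has no atoms, the two may be exchanged.\<close>

lemma prob_conj_less:
  assumes i: "i \<ge> 1" and [measurable]: "Measurable.pred M A"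
  shows "prob {\<omega> \<in> space M. A \<omega> \<and> eta i \<omega> < x} = prob {\<omega> \<in> space M. A \<omega> \<and> eta i \<omega> \<le> x}"
proof -
  note [measurable] = eta_measurable[OF i]
  show ?thesis
    by (rule finite_measure_eq_AE) (use AE_eta_neq[OF i, of x] in auto)
qed

lemma prob_less: "i \<ge> 1 \<Longrightarrow> x \<le> 0 \<Longrightarrow> prob {\<omega> \<in> space M. eta i \<omega> < x} = exp x"
  using prob_conj_less[of i "\<lambda>_. True" x] prob_le by simp

lemma prob_all_less:
  assumes "x \<le> 0" "finite I" "I \<subseteq> {1..}"
  shows "prob {\<omega> \<in> space M. \<forall>i\<in>I. eta i \<omega> < x} = exp (real (card I) * x)"
\<comment> \<open>The product rule for independent events requires a nonempty index set. The empty
  set does occur: there is nothing strictly between two consecutive indices.\<close>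
proof (cases "I = {}")
  case False
  have "{\<omega> \<in> space M. \<forall>i\<in>I. eta i \<omega> < x} = (\<Inter>i\<in>I. eta i -` {..<x} \<inter> space M)"
    using False by auto
  then have "prob {\<omega> \<in> space M. \<forall>i\<in>I. eta i \<omega> < x} = (\<Prod>i\<in>I. prob (eta i -` {..<x} \<inter> space M))"
    using indep_varsD[OF indep, of I "\<lambda>_. {..<x}"] False assms by simp
  also have "\<dots> = (\<Prod>i\<in>I. exp x)"
  proof (rule prod.cong)
    fix i assume "i \<in> I"
    moreover have "eta i -` {..<x} \<inter> space M = {\<omega> \<in> space M. eta i \<omega> < x}" by auto
    ultimately show "prob (eta i -` {..<x} \<inter> space M) = exp x" using prob_less assms by auto
  qed simp
  finally show ?thesis by (simp add: exp_of_nat_mult)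
qed (simp add: prob_space)

text \<open>This allows formulas with a threshold \<open>v\<close> to be used at
  \<open>v = 0\<close> for events without a threshold.\<close>

lemma prob_conj_le_0:
  assumes i: "i \<ge> 1" and [measurable]: "Measurable.pred M A"
  shows "prob {\<omega> \<in> space M. A \<omega> \<and> eta i \<omega> \<le> 0} = prob {\<omega> \<in> space M. A \<omega>}"
proof -
  note [measurable] = eta_measurable[OF i]
  have "AE \<omega> in M. eta i \<omega> \<le> 0"
    using prob_le[OF i, of 0] by (subst prob_Collect_eq_1[symmetric]) auto
  then show ?thesis
    by (intro finite_measure_eq_AE) auto
qed

text \<open>The conditioning step. The index blocks \<open>{1..j}\<close>, \<open>{j<..<m}\<close>
  and \<open>{m}\<close> are independent; given the value \<open>w\<close> at \<open>m\<close>, the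
  first block contributes the probability of \<open>Q\<close> at \<open>w\<close> and the others an
  exponential. \<open>Q\<close> takes a whole sequence but, by \<open>Q_restrict\<close>, sees only
  its first \<open>j\<close> terms, so that it can be measurable on a finite product and still be
  applied to \<open>eta\<close> directly.\<close>

lemma prob_new_maximum:
  fixes Q :: "(nat \<Rightarrow> real) \<Rightarrow> real \<Rightarrow> bool"
  assumes jm: "j < m" and v: "v \<le> 0"
    and Q: "Measurable.pred (PiM {1..j} (\<lambda>_. borel) \<Otimes>\<^sub>M borel) (\<lambda>(f, w). Q f w)"
    and Q_restrict: "\<And>f w. Q (restrict f {1..j}) w = Q f w"
  shows "prob {\<omega> \<in> space M. Q (\<lambda>i. eta i \<omega>) (eta m \<omega>) \<and> (\<forall>i\<in>{j<..<m}. eta i \<omega> < eta m \<omega>) \<and> eta m \<omega> \<le> v}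
    = (LBINT w:{..v}. prob {\<omega> \<in> space M. Q (\<lambda>i. eta i \<omega>) w} * exp (real (m - j) * w))"
proof -
  let ?P = "\<lambda>I. PiM I (\<lambda>_. borel :: real measure)"
  define X where "X = (\<lambda>\<omega>. restrict (\<lambda>i. eta i \<omega>) {1..<m})"
  define E where "E = {z \<in> space (?P {1..<m} \<Otimes>\<^sub>M borel).
    (case (restrict (fst z) {1..j}, snd z) of (f, w) \<Rightarrow> Q f w) \<and> (\<forall>i\<in>{j<..<m}. fst z i < snd z) \<and> snd z \<le> v}"
  have X_space: "X \<omega> \<in> space (?P {1..<m})" for \<omega>
    by (simp add: X_def space_PiM)
  have restr[measurable]: "(\<lambda>z. restrict (fst z) {1..j}) \<in> ?P {1..<m} \<Otimes>\<^sub>M borel \<rightarrow>\<^sub>M ?P {1..j}"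
    using jm by (intro measurable_compose[OF measurable_fst measurable_restrict_subset]) auto
  have [measurable]: "(\<lambda>z. fst z i) \<in> borel_measurable (?P {1..<m} \<Otimes>\<^sub>M borel)" if "i \<in> {j<..<m}" for i
    using that by (intro measurable_compose[OF measurable_fst measurable_component_singleton]) auto
  have QX: "Measurable.pred (?P {1..<m} \<Otimes>\<^sub>M borel) (\<lambda>z. case (restrict (fst z) {1..j}, snd z) of (f, w) \<Rightarrow> Q f w)"
    by (rule measurable_compose[OF _ Q]) measurable
  have E[measurable]: "E \<in> sets (?P {1..<m} \<Otimes>\<^sub>M borel)"
    unfolding E_def using QX by measurable
  have in_E: "(X \<omega>, w) \<in> E \<longleftrightarrow> Q (\<lambda>i. eta i \<omega>) w \<and> (\<forall>i\<in>{j<..<m}. eta i \<omega> < w) \<and> w \<le> v" for \<omega> w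
  proof -
    have "restrict (X \<omega>) {1..j} = restrict (\<lambda>i. eta i \<omega>) {1..j}"
      using jm by (auto simp: X_def fun_eq_iff)
    then have "Q (restrict (X \<omega>) {1..j}) w \<longleftrightarrow> Q (\<lambda>i. eta i \<omega>) w"
      by (simp only: Q_restrict)
    moreover have "X \<omega> i = eta i \<omega>" if "i \<in> {j<..<m}" for i
      using that by (auto simp: X_def)
    ultimately show ?thesis
      using X_space[of \<omega>] by (auto simp: E_def space_pair_measure)
  qed
  have "indep_var (?P {1..<m}) X (?P {m}) (\<lambda>\<omega>. restrict (\<lambda>i. eta i \<omega>) {m})"
    unfolding X_def using jm by (intro indep_var_restrict[OF indep]) auto
  note pair = prob_indep_pair[OF this measurable_component_singleton E, of m, simplified]
  \<comment> \<open>For fixed \<open>w\<close> the event is a rectangle over the first two blocks,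
    so its probability factors.\<close>
  have slice: "prob {\<omega> \<in> space M. (X \<omega>, w) \<in> E}
      = indicator {..v} w * (prob {\<omega> \<in> space M. Q (\<lambda>i. eta i \<omega>) w} * exp (real (m - j - 1) * w))" for w
  proof (cases "w \<le> v")
    case True
    let ?A = "{f \<in> space (?P {1..j}). Q f w}" and ?B = "{f \<in> space (?P {j<..<m}). \<forall>i\<in>{j<..<m}. f i < w}"
    let ?Y = "\<lambda>\<omega>. restrict (\<lambda>i. eta i \<omega>) {1..j}" and ?Z = "\<lambda>\<omega>. restrict (\<lambda>i. eta i \<omega>) {j<..<m}"
    have "Measurable.pred (?P {1..j}) (\<lambda>f. case (f, w) of (f, w) \<Rightarrow> Q f w)"
      by (rule measurable_compose[OF _ Q]) measurable
    then have A: "?A \<in> sets (?P {1..j})" by simp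
    have B: "?B \<in> sets (?P {j<..<m})" by measurable
    have "prob {\<omega> \<in> space M. (X \<omega>, w) \<in> E} = prob ((\<lambda>\<omega>. (?Y \<omega>, ?Z \<omega>)) -` (?A \<times> ?B) \<inter> space M)"
      using True by (intro arg_cong[where f = prob]) (auto simp: in_E Q_restrict space_PiM simp del: One_nat_def)
    also have "\<dots> = prob (?Y -` ?A \<inter> space M) * prob (?Z -` ?B \<inter> space M)"
      by (rule indep_varD[OF indep_var_restrict[OF indep] A B]) auto
    also have "?Y -` ?A \<inter> space M = {\<omega> \<in> space M. Q (\<lambda>i. eta i \<omega>) w}"
      by (auto simp: Q_restrict space_PiM simp del: One_nat_def)
    also have "?Z -` ?B \<inter> space M = {\<omega> \<in> space M. \<forall>i\<in>{j<..<m}. eta i \<omega> < w}"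
      by (auto simp: space_PiM)
    also have "prob \<dots> = exp (real (m - j - 1) * w)"
      using True v by (subst prob_all_less) auto
    finally show ?thesis using True by simp
  qed (simp add: in_E)
  have m: "m \<ge> 1" using jm by simp
  have "prob {\<omega> \<in> space M. Q (\<lambda>i. eta i \<omega>) (eta m \<omega>) \<and> (\<forall>i\<in>{j<..<m}. eta i \<omega> < eta m \<omega>) \<and> eta m \<omega> \<le> v}
      = (\<integral>w. prob {\<omega> \<in> space M. (X \<omega>, w) \<in> E} \<partial>distr M borel (eta m))"
    using pair(1) by (simp add: in_E)
  also have "\<dots> = (\<integral>w. (exp w * indicator {..0} w) *\<^sub>R prob {\<omega> \<in> space M. (X \<omega>, w) \<in> E} \<partial>lborel)"
    unfolding distr_eta[OF m] using pair(2) by (intro integral_density) auto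
  also have "\<dots> = (LBINT w:{..v}. prob {\<omega> \<in> space M. Q (\<lambda>i. eta i \<omega>) w} * exp (real (m - j) * w))"
    unfolding set_lebesgue_integral_def
  proof (intro Bochner_Integration.integral_cong refl)
    fix w
    \<comment> \<open>Only \<open>m - j - 1\<close> variables lie strictly between \<open>j\<close>
      and \<open>m\<close>; the density of \<open>eta m\<close> supplies the missing factor
      \<open>exp w\<close>.\<close>
    have "real (m - j) = 1 + real (m - j - 1)" using jm by simp
    then have "exp (real (m - j) * w) = exp w * exp (real (m - j - 1) * w)"
      by (simp only: distrib_right exp_add mult_1)
    then show "(exp w * indicator {..0} w) *\<^sub>R prob {\<omega> \<in> space M. (X \<omega>, w) \<in> E}
        = indicator {..v} w *\<^sub>R (prob {\<omega> \<in> space M. Q (\<lambda>i. eta i \<omega>) w} * exp (real (m - j) * w))"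
      using v by (simp add: slice indicator_def)
  qed
  finally show ?thesis .
qed

text \<open>A record at \<open>m\<close> is a new maximum over an empty past:
  \<open>prob_new_maximum\<close> with \<open>j = 0\<close> and trivial \<open>Q\<close>.\<close>

lemma prob_record_le:
  assumes m: "m \<ge> 1" and v: "v \<le> 0"
  shows "prob {\<omega> \<in> space M. is_record eta m \<omega> \<and> eta m \<omega> \<le> v} = exp (real m * v) / real m"
proof -
  have "{1..<m} = {0<..<m}" by auto
  then show ?thesis
    using prob_new_maximum[of 0 m v "\<lambda>_ _. True"] assms
    by (simp add: is_record_def prob_space set_integral_exp_atMost)
qed

text \<open>The bounds on \<open>eta i\<close> cut out a difference of two nested events, both of
  the kind covered by the exact formulas.\<close>

lemma prob_gap:
  assumes i: "i \<ge> 1" and y: "y \<ge> 0" and [measurable]: "Measurable.pred M A"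
  shows "prob {\<omega> \<in> space M. A \<omega> \<and> eta i \<omega> < w \<and> w - eta i \<omega> \<le> y}
    = prob {\<omega> \<in> space M. A \<omega> \<and> eta i \<omega> \<le> w} - prob {\<omega> \<in> space M. A \<omega> \<and> eta i \<omega> \<le> w - y}"
proof -
  note [measurable] = eta_measurable[OF i]
  have "{\<omega> \<in> space M. A \<omega> \<and> eta i \<omega> < w \<and> w - eta i \<omega> \<le> y}
      = {\<omega> \<in> space M. A \<omega> \<and> eta i \<omega> < w} - {\<omega> \<in> space M. A \<omega> \<and> eta i \<omega> < w - y}"
    by auto
  also have "prob \<dots> = prob {\<omega> \<in> space M. A \<omega> \<and> eta i \<omega> < w} - prob {\<omega> \<in> space M. A \<omega> \<and> eta i \<omega> < w - y}"
    using y by (intro finite_measure_Diff) auto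
  finally show ?thesis using prob_conj_less i by simp
qed

end

section \<open>Records as events on finitely many coordinates\<close>

text \<open>A record at \<open>k\<close> already exceeds everything before it, so the past enters
  the next record only through \<open>eta k\<close>. This gives the event the shape required by
  \<open>prob_new_maximum\<close>.\<close>

lemma is_record_iff_after:
  assumes "1 \<le> k" "k < m" "is_record eta k \<omega>"
  shows "is_record eta m \<omega> \<longleftrightarrow> eta k \<omega> < eta m \<omega> \<and> (\<forall>i\<in>{k<..<m}. eta i \<omega> < eta m \<omega>)"
proof -
  have "{1..<m} = {1..<k} \<union> {k} \<union> {k<..<m}" using assms by auto
  then show ?thesis using assms by (auto simp: is_record_def)
qed

text \<open>With the coordinate process \<open>\<lambda>k g. g k\<close> in place of
  \<open>eta\<close>, being a record becomes a predicate on plain sequences, as \<open>Q\<close> in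
  \<open>prob_new_maximum\<close> has to be.\<close>

lemma is_record_restrict:
  assumes "m \<in> {1..n}"
  shows "is_record (\<lambda>k g. g k) m (restrict f {1..n}) \<longleftrightarrow> is_record (\<lambda>k g. g k) m f"
  using assms by (auto simp: is_record_def)

lemma is_record_measurable:
  assumes "m \<in> {1..n}"
  shows "Measurable.pred (PiM {1..n} (\<lambda>_. borel)) (is_record (\<lambda>k g. g k) m)"
proof -
  have [measurable]: "(\<lambda>f. f i) \<in> borel_measurable (PiM {1..n} (\<lambda>_. borel :: real measure))" if "i \<in> {1..<m} \<union> {m}" for i
    using that assms by (intro measurable_component_singleton) auto
  show ?thesis unfolding is_record_def by measurable
qed

lemma is_record_eta: "is_record (\<lambda>k g. g k) m (\<lambda>i. eta i \<omega>) \<longleftrightarrow> is_record eta m \<omega>"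
  by (simp add: is_record_def)

lemma (in neg_exponential_sequence) pred_is_record:
  assumes "m \<ge> 1"
  shows "Measurable.pred M (is_record eta m)"
proof -
  have [measurable]: "eta i \<in> borel_measurable M" if "i \<in> {1..<m} \<union> {m}" for i
    using that assms eta_measurable by auto
  show ?thesis unfolding is_record_def by measurable
qed

text \<open>The set \<open>K\<close> selects the constrained gaps: the numerator in (i) has \<open>K = UNIV\<close>, the denominator \<open>K = {}\<close>.\<close>

definition record_chain :: "nat set \<Rightarrow> (nat \<Rightarrow> real) \<Rightarrow> (nat \<Rightarrow> nat) \<Rightarrow> nat \<Rightarrow> (nat \<Rightarrow> real) \<Rightarrow> bool" where
  "record_chain K y r s f \<longleftrightarrow> (\<forall>i\<in>{1..s}. is_record (\<lambda>k g. g k) (r i) f)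
    \<and> (\<forall>i\<in>{1..<s} \<inter> K. f (r (Suc i)) - f (r i) \<le> y i)"

section \<open>Exact probabilities for records at prescribed indices\<close>

text \<open>Here \<open>n\<close> is frozen: \<open>r i\<close> stands for \<open>j i n\<close>, and
  no limit is involved.\<close>

locale record_indices = neg_exponential_sequence +
  fixes r :: "nat \<Rightarrow> nat"
  assumes r_1: "r 1 \<ge> 1" and r_less: "\<And>i. i \<ge> 1 \<Longrightarrow> r i < r (Suc i)"
begin

lemma r_mono:
  assumes "1 \<le> i" "i \<le> k"
  shows "r i \<le> r k"
  using assms(2)
proof (induction k rule: dec_induct)
  case (step k)
  then show ?case using r_less[of k] assms(1) by simp
qed simp

lemma r_pos: "1 \<le> i \<Longrightarrow> 1 \<le> r i"
  using r_mono[of 1 i] r_1 by linarith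

lemma record_chain_restrict:
  "record_chain K y r s (restrict f {1..r s}) \<longleftrightarrow> record_chain K y r s f"
proof -
  have "r i \<in> {1..r s}" if "i \<in> {1..s}" for i
    using that r_mono[of i s] r_pos[of i] by auto
  moreover have "r i \<in> {1..r s}" "r (Suc i) \<in> {1..r s}" if "i \<in> {1..<s}" for i
    using that r_mono[of i s] r_pos[of i] r_mono[of "Suc i" s] r_pos[of "Suc i"] by auto
  ultimately show ?thesis
    unfolding record_chain_def by (intro arg_cong2[of _ _ _ _ "(\<and>)"] ball_cong refl) (auto simp: is_record_restrict simp del: One_nat_def)
qed

lemma record_chain_measurable:
  "Measurable.pred (PiM {1..r s} (\<lambda>_. borel)) (record_chain K y r s)"
proof -
  have r_in: "r i \<in> {1..r s}" if "i \<in> {1..s}" for i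
    using that r_mono[of i s] r_pos[of i] by auto
  have "Measurable.pred (PiM {1..r s} (\<lambda>_. borel :: real measure)) (\<lambda>f. f (r (Suc i)) - f (r i) \<le> y i)"
    if "i \<in> {1..<s} \<inter> K" for i
  proof -
    have [measurable]: "(\<lambda>f. f (r k)) \<in> borel_measurable (PiM {1..r s} (\<lambda>_. borel :: real measure))" if "k \<in> {i, Suc i}" for k
      using that \<open>i \<in> {1..<s} \<inter> K\<close> by (intro measurable_component_singleton r_in) auto
    show ?thesis by measurable
  qed
  then show ?thesis
    unfolding record_chain_def by (intro pred_intros_logic pred_intros_finite is_record_measurable r_in) auto
qed

lemma pred_record_chain: "Measurable.pred M (\<lambda>\<omega>. record_chain K y r s (\<lambda>i. eta i \<omega>))"
proof -
  have "(\<lambda>\<omega>. restrict (\<lambda>i. eta i \<omega>) {1..r s}) \<in> M \<rightarrow>\<^sub>M PiM {1..r s} (\<lambda>_. borel)"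
    using eta_measurable by (intro measurable_restrict) auto
  from measurable_compose[OF this record_chain_measurable] show ?thesis
    by (simp only: record_chain_restrict)
qed

text \<open>The bracketed group is the predicate \<open>Q\<close> for
  \<open>prob_new_maximum\<close>, taken at the new record value; the last conjunct is the condition
  on the indices in between.\<close>

lemma record_chain_Suc:
  assumes "s \<ge> 1"
  shows "record_chain K y r (Suc s) f \<longleftrightarrow> (record_chain K y r s f \<and> f (r s) < f (r (Suc s))
    \<and> (s \<in> K \<longrightarrow> f (r (Suc s)) - f (r s) \<le> y s)) \<and> (\<forall>i\<in>{r s<..<r (Suc s)}. f i < f (r (Suc s)))"
proof -
  have "{1..Suc s} = insert (Suc s) {1..s}" "{1..<Suc s} \<inter> K = {1..<s} \<inter> K \<union> ({s} \<inter> K)"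
    using assms by auto
  moreover have "is_record (\<lambda>k g. g k) (r (Suc s)) f \<longleftrightarrow> f (r s) < f (r (Suc s)) \<and> (\<forall>i\<in>{r s<..<r (Suc s)}. f i < f (r (Suc s)))"
    if "\<forall>i\<in>{1..s}. is_record (\<lambda>k g. g k) (r i) f"
    using is_record_iff_after[of "r s" "r (Suc s)" "\<lambda>k g. g k" f] that r_pos[of s] r_less[of s] assms by auto
  ultimately show ?thesis
    unfolding record_chain_def by (simp only:) auto
qed

text \<open>The threshold \<open>v\<close> carries the induction: the step integrates over the value
  \<open>w\<close> of the new record and needs the formula for \<open>s\<close> at every
  \<open>w\<close> up to \<open>v\<close>, and at \<open>w - y s\<close> as well when gap
  \<open>s\<close> is constrained.\<close>

lemma prob_record_chain_le:
  assumes "s \<ge> 1" "v \<le> 0" "\<And>i. i \<in> {1..<s} \<inter> K \<Longrightarrow> y i \<ge> 0"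
  shows "prob {\<omega> \<in> space M. record_chain K y r s (\<lambda>i. eta i \<omega>) \<and> eta (r s) \<omega> \<le> v}
    = (\<Prod>i\<in>{1..<s} \<inter> K. 1 - exp (- real (r i) * y i)) / (\<Prod>i=1..s. real (r i)) * exp (real (r s) * v)"
  using assms
proof (induction s arbitrary: v rule: nat_induct_at_least)
  case base
  have "record_chain K y r 1 (\<lambda>i. eta i \<omega>) \<longleftrightarrow> is_record eta (r 1) \<omega>" for \<omega>
    by (simp add: record_chain_def is_record_def)
  then show ?case
    using base prob_record_le[of "r 1" v] r_1 by simp
next
  case (Suc s)
  let ?C = "\<lambda>s. (\<Prod>i\<in>{1..<s} \<inter> K. 1 - exp (- real (r i) * y i)) / (\<Prod>i=1..s. real (r i))"
  let ?q = "if s \<in> K then 1 - exp (- real (r s) * y s) else 1"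
  let ?Q = "\<lambda>f w. record_chain K y r s f \<and> f (r s) < w \<and> (s \<in> K \<longrightarrow> w - f (r s) \<le> y s)"
  have rs: "r s \<ge> 1" and rless: "r s < r (Suc s)" using Suc r_pos r_less by auto
  have [measurable]: "(\<lambda>z. fst z (r s)) \<in> borel_measurable (PiM {1..r s} (\<lambda>_. borel) \<Otimes>\<^sub>M (borel :: real measure))"
    using rs by (intro measurable_compose[OF measurable_fst measurable_component_singleton]) auto
  have [measurable]: "Measurable.pred (PiM {1..r s} (\<lambda>_. borel) \<Otimes>\<^sub>M (borel :: real measure)) (\<lambda>z. record_chain K y r s (fst z))"
    by (rule measurable_compose[OF measurable_fst record_chain_measurable])
  have Q_meas: "Measurable.pred (PiM {1..r s} (\<lambda>_. borel) \<Otimes>\<^sub>M borel) (\<lambda>(f, w). ?Q f w)"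
    unfolding split_beta' by measurable
  have Q_restrict: "?Q (restrict f {1..r s}) w = ?Q f w" for f w
    using rs by (simp add: record_chain_restrict del: One_nat_def)
  let ?chain = "\<lambda>\<omega>. record_chain K y r s (\<lambda>i. eta i \<omega>)"
  note chain = pred_record_chain[of K y s]
  have IH: "prob {\<omega> \<in> space M. record_chain K y r s (\<lambda>i. eta i \<omega>) \<and> eta (r s) \<omega> \<le> w} = ?C s * exp (real (r s) * w)"
    if "w \<le> 0" for w
    using Suc.IH[OF that] Suc.prems by auto
  have slice: "prob {\<omega> \<in> space M. ?Q (\<lambda>i. eta i \<omega>) w} = ?C s * ?q * exp (real (r s) * w)" if w: "w \<le> 0" for w
  proof (cases "s \<in> K")
    case True
    then have y: "y s \<ge> 0" using Suc by auto
    \<comment> \<open>Shifting the threshold by \<open>y s\<close> costs a factor free of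
      \<open>w\<close>. Hence the gap contributes the constant \<open>?q\<close> and the exponential
      form survives.\<close>
    have "exp (real (r s) * (w - y s)) = exp (- real (r s) * y s) * exp (real (r s) * w)"
      by (simp add: exp_add[symmetric] algebra_simps)
    moreover have "prob {\<omega> \<in> space M. ?Q (\<lambda>i. eta i \<omega>) w} = ?C s * exp (real (r s) * w) - ?C s * exp (real (r s) * (w - y s))"
      using prob_gap[of "r s" "y s" ?chain w, OF rs y chain] IH[OF w] IH[of "w - y s"] w y True by simp
    ultimately show ?thesis
      using True by (simp only: if_True left_diff_distrib right_diff_distrib mult_1 mult_1_right mult.assoc)
  qed (use prob_conj_less[of "r s" ?chain w, OF rs chain] IH[OF w] in simp)
  have "prob {\<omega> \<in> space M. record_chain K y r (Suc s) (\<lambda>i. eta i \<omega>) \<and> eta (r (Suc s)) \<omega> \<le> v}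
      = (LBINT w:{..v}. prob {\<omega> \<in> space M. ?Q (\<lambda>i. eta i \<omega>) w} * exp (real (r (Suc s) - r s) * w))"
    unfolding record_chain_Suc[OF \<open>1 \<le> s\<close>] conj_assoc
    using prob_new_maximum[where Q = ?Q, OF rless \<open>v \<le> 0\<close> Q_meas Q_restrict] unfolding conj_assoc .
  also have "\<dots> = (LBINT w:{..v}. ?C s * ?q * exp (real (r (Suc s)) * w))"
  proof (intro set_lebesgue_integral_cong allI impI)
    fix w assume "w \<in> {..v}"
    then have w: "w \<le> 0" using \<open>v \<le> 0\<close> by simp
    have "exp (real (r s) * w) * exp (real (r (Suc s) - r s) * w) = exp (real (r (Suc s)) * w)"
      using rless by (simp add: exp_add[symmetric] algebra_simps)
    then show "prob {\<omega> \<in> space M. ?Q (\<lambda>i. eta i \<omega>) w} * exp (real (r (Suc s) - r s) * w)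
        = ?C s * ?q * exp (real (r (Suc s)) * w)"
      unfolding slice[OF w] by (simp only: mult.assoc)
  qed simp
  also have "\<dots> = ?C s * ?q * (exp (real (r (Suc s)) * v) / real (r (Suc s)))"
    using rless by (simp only: set_integral_mult_right set_integral_exp_atMost of_nat_0_less_iff)
  also have "\<dots> = ?C (Suc s) * exp (real (r (Suc s)) * v)"
  proof -
    have "{1..<Suc s} \<inter> K = (if s \<in> K then insert s ({1..<s} \<inter> K) else {1..<s} \<inter> K)"
      using Suc.hyps by (auto simp: less_Suc_eq)
    then have "(\<Prod>i\<in>{1..<Suc s} \<inter> K. 1 - exp (- real (r i) * y i)) = (\<Prod>i\<in>{1..<s} \<inter> K. 1 - exp (- real (r i) * y i)) * ?q"
      by simp
    moreover have "(\<Prod>i=1..Suc s. real (r i)) = (\<Prod>i=1..s. real (r i)) * real (r (Suc s))"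
      by simp
    ultimately show ?thesis by (simp only: divide_inverse inverse_mult_distrib mult_ac)
  qed
  finally show ?case .
qed

text \<open>The threshold is removed by \<open>v = 0\<close>. For \<open>K = {}\<close> the result
  is the product of the probabilities \<open>1 / r i\<close>, so records at the different indices
  are independent events.\<close>

lemma prob_record_chain:
  assumes "s \<ge> 1" "\<And>i. i \<in> {1..<s} \<inter> K \<Longrightarrow> y i \<ge> 0"
  shows "prob {\<omega> \<in> space M. record_chain K y r s (\<lambda>i. eta i \<omega>)}
    = (\<Prod>i\<in>{1..<s} \<inter> K. 1 - exp (- real (r i) * y i)) / (\<Prod>i=1..s. real (r i))"
  using prob_record_chain_le[OF assms(1), of 0 K y] assms(2) r_pos[OF assms(1)]
    prob_conj_le_0[of "r s" "\<lambda>\<omega>. record_chain K y r s (\<lambda>i. eta i \<omega>)", OF _ pred_record_chain]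
  by simp

text \<open>This is the quotient of the cases \<open>K = UNIV\<close> and \<open>K = {}\<close>, in
  which the product of the indices cancels.\<close>

lemma cond_prob_gaps:
  assumes "s \<ge> 1" "\<And>i. i \<in> {1..s-1} \<Longrightarrow> y i \<ge> 0"
  shows "cond_prob_el M {\<omega> \<in> space M. \<forall>i\<in>{1..s-1}. eta (r (Suc i)) \<omega> - eta (r i) \<omega> \<le> y i}
      {\<omega> \<in> space M. \<forall>i\<in>{1..s}. is_record eta (r i) \<omega>}
    = (\<Prod>i=1..s-1. 1 - exp (- real (r i) * y i))"
proof -
  have idx: "{1..<s} = {1..s-1}" using assms(1) by auto
  have "{\<omega> \<in> space M. \<forall>i\<in>{1..s-1}. eta (r (Suc i)) \<omega> - eta (r i) \<omega> \<le> y i}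
      \<inter> {\<omega> \<in> space M. \<forall>i\<in>{1..s}. is_record eta (r i) \<omega>} = {\<omega> \<in> space M. record_chain UNIV y r s (\<lambda>i. eta i \<omega>)}"
    unfolding record_chain_def is_record_eta idx by auto
  moreover have "{\<omega> \<in> space M. \<forall>i\<in>{1..s}. is_record eta (r i) \<omega>} = {\<omega> \<in> space M. record_chain {} y r s (\<lambda>i. eta i \<omega>)}"
    unfolding record_chain_def is_record_eta by auto
  moreover have "(\<Prod>i=1..s. real (r i)) \<noteq> 0"
    using r_pos by (auto simp: Suc_le_eq)
  ultimately show ?thesis
    using assms prob_record_chain[OF assms(1), of UNIV y] prob_record_chain[OF assms(1), of "{}" y]
    unfolding cond_prob_el_def by (simp add: idx del: One_nat_def)
qed

text \<open>The extra bound \<open>x\<close> on the first record destroys the pure exponential form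
  used for chains, so the integral over the value of the second record is computed directly, with
  minima in the exponents.\<close>

lemma prob_two_records:
  assumes x: "x \<le> 0" and y: "y > 0"
  shows "prob {\<omega> \<in> space M. is_record eta (r 1) \<omega> \<and> is_record eta (r 2) \<omega>
      \<and> eta (r 1) \<omega> \<le> x \<and> eta (r 2) \<omega> - eta (r 1) \<omega> \<le> y}
    = Qfun (r 1) (r 2) x y / (real (r 1) * real (r 2))"
proof -
  \<comment> \<open>Bounding the first record by both \<open>w - y\<close> and \<open>x\<close>
    amounts to the bound \<open>min w (x + y) - y\<close>. For \<open>w\<close> at most 0, capping
    \<open>x + y\<close> at 0 changes nothing, and it provides the nonpositive threshold that
    \<open>set_integral_exp_min\<close> asks for.\<close>
  define p q z where "p = real (r 1)" and "q = real (r 2)" and "z = min (x + y) 0"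
  have pos: "r 1 \<ge> 1" "r 2 \<ge> 1" and less: "r 1 < r 2"
    using r_1 r_less[of 1] by (simp_all add: numeral_2_eq_2)
  then have pq: "0 < p" "p < q" by (simp_all add: p_def q_def)
  have d: "real (r 2 - r 1) = q - p" using less by (simp add: p_def q_def)
  note [measurable] = eta_measurable[OF pos(1)] eta_measurable[OF pos(2)]
  note [measurable] = pred_is_record[OF pos(1)] pred_is_record[OF pos(2)]
  let ?R = "is_record (\<lambda>k g. g k) (r 1)"
  let ?Q = "\<lambda>f w. (?R f \<and> f (r 1) \<le> x) \<and> f (r 1) < w \<and> w - f (r 1) \<le> y"
  have [measurable]: "(\<lambda>z. fst z (r 1)) \<in> borel_measurable (PiM {1..r 1} (\<lambda>_. borel) \<Otimes>\<^sub>M (borel :: real measure))"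
    using pos by (intro measurable_compose[OF measurable_fst measurable_component_singleton]) auto
  have [measurable]: "Measurable.pred (PiM {1..r 1} (\<lambda>_. borel) \<Otimes>\<^sub>M (borel :: real measure)) (\<lambda>z. ?R (fst z))"
    using pos by (intro measurable_compose[OF measurable_fst is_record_measurable]) auto
  have Q_meas: "Measurable.pred (PiM {1..r 1} (\<lambda>_. borel) \<Otimes>\<^sub>M borel) (\<lambda>(f, w). ?Q f w)"
    unfolding split_beta' by measurable
  have Q_restrict: "?Q (restrict f {1..r 1}) w = ?Q f w" for f w
    using pos by (simp add: is_record_restrict del: One_nat_def)
  have F: "prob {\<omega> \<in> space M. (is_record eta (r 1) \<omega> \<and> eta (r 1) \<omega> \<le> x) \<and> eta (r 1) \<omega> \<le> w} = exp (p * min w x) / p" for w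
    using prob_record_le[OF pos(1), of "min w x"] x by (simp add: conj_ac p_def)
  have slice: "prob {\<omega> \<in> space M. ?Q (\<lambda>i. eta i \<omega>) w} = (exp (p * min w x) - exp (- p * y) * exp (p * min w z)) / p" if "w \<le> 0" for w
  proof -
    have eq: "min (w - y) x = min w z - y" using that by (auto simp: z_def min_def)
    have "exp (p * min (w - y) x) = exp (- p * y) * exp (p * min w z)"
      unfolding eq by (simp add: exp_add[symmetric] algebra_simps)
    moreover have "Measurable.pred M (\<lambda>\<omega>. is_record eta (r 1) \<omega> \<and> eta (r 1) \<omega> \<le> x)"
      by measurable
    note prob_gap[OF pos(1) less_imp_le[OF y] this, of w]
    ultimately show ?thesis
      by (simp only: F is_record_eta diff_divide_distrib)
  qed
  let ?L = "{\<omega> \<in> space M. is_record eta (r 1) \<omega> \<and> is_record eta (r 2) \<omega>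
      \<and> eta (r 1) \<omega> \<le> x \<and> eta (r 2) \<omega> - eta (r 1) \<omega> \<le> y}"
  \<comment> \<open>The almost sure bound on the second record is inserted to match
    \<open>prob_new_maximum\<close> at \<open>v = 0\<close>.\<close>
  have "prob ?L = prob {\<omega> \<in> space M. (is_record eta (r 1) \<omega> \<and> is_record eta (r 2) \<omega>
      \<and> eta (r 1) \<omega> \<le> x \<and> eta (r 2) \<omega> - eta (r 1) \<omega> \<le> y) \<and> eta (r 2) \<omega> \<le> 0}"
    by (rule prob_conj_le_0[symmetric, OF pos(2)]) measurable
  moreover have "{\<omega> \<in> space M. (is_record eta (r 1) \<omega> \<and> is_record eta (r 2) \<omega>
      \<and> eta (r 1) \<omega> \<le> x \<and> eta (r 2) \<omega> - eta (r 1) \<omega> \<le> y) \<and> eta (r 2) \<omega> \<le> 0}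
    = {\<omega> \<in> space M. ?Q (\<lambda>i. eta i \<omega>) (eta (r 2) \<omega>) \<and> (\<forall>i\<in>{r 1<..<r 2}. eta i \<omega> < eta (r 2) \<omega>) \<and> eta (r 2) \<omega> \<le> 0}"
    using is_record_iff_after[OF pos(1) less, of eta] by (auto simp: is_record_eta)
  ultimately have "prob ?L = prob {\<omega> \<in> space M. ?Q (\<lambda>i. eta i \<omega>) (eta (r 2) \<omega>)
      \<and> (\<forall>i\<in>{r 1<..<r 2}. eta i \<omega> < eta (r 2) \<omega>) \<and> eta (r 2) \<omega> \<le> 0}"
    by simp
  also have "\<dots> = (LBINT w:{..0}. prob {\<omega> \<in> space M. ?Q (\<lambda>i. eta i \<omega>) w} * exp (real (r 2 - r 1) * w))"
    using prob_new_maximum[where Q = ?Q, OF less order.refl Q_meas Q_restrict] .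
  also have "\<dots> = (LBINT w:{..0}. (1 / p) * (exp (p * min w x) * exp ((q - p) * w)
      - exp (- p * y) * (exp (p * min w z) * exp ((q - p) * w))))"
  proof (intro set_lebesgue_integral_cong allI impI)
    fix w :: real assume "w \<in> {..0}"
    then have w: "w \<le> 0" by simp
    show "prob {\<omega> \<in> space M. ?Q (\<lambda>i. eta i \<omega>) w} * exp (real (r 2 - r 1) * w)
      = (1 / p) * (exp (p * min w x) * exp ((q - p) * w) - exp (- p * y) * (exp (p * min w z) * exp ((q - p) * w)))"
      unfolding slice[OF w] d by (simp add: left_diff_distrib mult.assoc)
  qed simp
  also have "\<dots> = ((exp (q * x) / q + (exp (p * x) - exp (q * x)) / (q - p))
      - exp (- p * y) * (exp (q * z) / q + (exp (p * z) - exp (q * z)) / (q - p))) / p"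
    using pq x set_integral_exp_min[of p "q - p" x] set_integral_exp_min[of p "q - p" z]
      set_integrable_exp_min[of p "q - p" x] set_integrable_exp_min[of p "q - p" z]
    by (subst set_integral_mult_right, subst set_integral_diff) (auto simp: z_def)
  also have "\<dots> = Qfun p q x y / (p * q)"
    unfolding Qfun_conv_min[OF pq x] z_def using pq by simp
  finally show ?thesis by (simp add: p_def q_def)
qed

text \<open>The conditioning event has probability \<open>1 / (r 1 * r 2)\<close>, which cancels the
  denominator in \<open>prob_two_records\<close>.\<close>

lemma cond_prob_two_records:
  assumes "x \<le> 0" "y > 0"
  shows "cond_prob_el M {\<omega> \<in> space M. eta (r 1) \<omega> \<le> x \<and> eta (r 2) \<omega> - eta (r 1) \<omega> \<le> y}
      {\<omega> \<in> space M. is_record eta (r 1) \<omega> \<and> is_record eta (r 2) \<omega>} = Qfun (r 1) (r 2) x y"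
proof -
  have two: "{1..2} = {1, 2 :: nat}" "{Suc 0..2} = {Suc 0, 2}" by auto
  have "{\<omega> \<in> space M. is_record eta (r 1) \<omega> \<and> is_record eta (r 2) \<omega>} = {\<omega> \<in> space M. record_chain {} y' r 2 (\<lambda>i. eta i \<omega>)}" for y'
    unfolding record_chain_def is_record_eta two by auto
  then have "prob {\<omega> \<in> space M. is_record eta (r 1) \<omega> \<and> is_record eta (r 2) \<omega>} = 1 / (real (r 1) * real (r 2))"
    using prob_record_chain[of 2 "{}"] by (simp add: two)
  moreover have "{\<omega> \<in> space M. eta (r 1) \<omega> \<le> x \<and> eta (r 2) \<omega> - eta (r 1) \<omega> \<le> y}
      \<inter> {\<omega> \<in> space M. is_record eta (r 1) \<omega> \<and> is_record eta (r 2) \<omega>}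
    = {\<omega> \<in> space M. is_record eta (r 1) \<omega> \<and> is_record eta (r 2) \<omega>
      \<and> eta (r 1) \<omega> \<le> x \<and> eta (r 2) \<omega> - eta (r 1) \<omega> \<le> y}"
    by auto
  moreover have "real (r 1) * real (r 2) \<noteq> 0" using r_pos[of 1] r_pos[of 2] by simp
  ultimately show ?thesis
    unfolding cond_prob_el_def using prob_two_records[OF assms] by simp
qed

end

section \<open>Passage to the limit\<close>

theorem theorem12:
  fixes M :: "'a measure" and eta :: "nat \<Rightarrow> 'a \<Rightarrow> real"
    and j :: "nat \<Rightarrow> nat \<Rightarrow> nat" and lam :: "nat \<Rightarrow> real"
  assumes "prob_space M"
    and indep: "prob_space.indep_vars M (\<lambda>_. borel) eta {1..}"
    and distr: "\<And>i x. i \<ge> 1 \<Longrightarrow> x \<le> 0 \<Longrightarrow>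
                  measure M {\<omega> \<in> space M. eta i \<omega> \<le> x} = exp x"
    and j_pos: "\<And>n. j 1 n \<ge> 1"
    and j_mono: "\<And>i n. i \<ge> 1 \<Longrightarrow> j i n < j (Suc i) n"
    and j_lim: "\<And>i. i \<ge> 1 \<Longrightarrow> (\<lambda>n. real (j i n) / real n) \<longlonglongrightarrow> lam i"
    and lam_pos: "lam 1 > 0"
    and lam_mono: "\<And>i. i \<ge> 1 \<Longrightarrow> lam i < lam (Suc i)"
  shows
    "(\<forall>s::nat. \<forall>y::nat \<Rightarrow> real. s \<ge> 2 \<longrightarrow> (\<forall>i\<in>{1..s-1}. y i > 0) \<longrightarrow>
        (\<lambda>n. cond_prob_el M
              {\<omega> \<in> space M. \<forall>i\<in>{1..s-1}. eta (j (Suc i) n) \<omega> - eta (j i n) \<omega> \<le> y i / real n}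
              {\<omega> \<in> space M. \<forall>i\<in>{1..s}. is_record eta (j i n) \<omega>})
        \<longlonglongrightarrow> (\<Prod>i=1..s-1. 1 - exp (- lam i * y i)))
     \<and>
     (\<forall>x y :: real. x \<le> 0 \<longrightarrow> y > 0 \<longrightarrow>
        (\<lambda>n. cond_prob_el M
              {\<omega> \<in> space M. eta (j 1 n) \<omega> \<le> x / real n \<and>
                              eta (j 2 n) \<omega> - eta (j 1 n) \<omega> \<le> y / real n}
              {\<omega> \<in> space M. is_record eta (j 1 n) \<omega> \<and> is_record eta (j 2 n) \<omega>})
        \<longlonglongrightarrow> Qfun (lam 1) (lam 2) x y)"
proof (intro conjI allI impI)
  have rec: "record_indices M eta (\<lambda>i. j i n)" for n
    using assms by (auto simp: record_indices_def neg_exponential_sequence_def record_indices_axioms_def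
        neg_exponential_sequence_axioms_def)
  {
    fix s :: nat and y :: "nat \<Rightarrow> real"
    assume s: "s \<ge> 2" and y: "\<forall>i\<in>{1..s-1}. y i > 0"
    \<comment> \<open>Regrouping \<open>r i * (y i / n)\<close> as \<open>(r i / n) * y i\<close>
      brings in the convergent ratios. The identity holds at \<open>n = 0\<close> too, since
      division by zero gives 0 on both sides.\<close>
    have "cond_prob_el M {\<omega> \<in> space M. \<forall>i\<in>{1..s-1}. eta (j (Suc i) n) \<omega> - eta (j i n) \<omega> \<le> y i / real n}
        {\<omega> \<in> space M. \<forall>i\<in>{1..s}. is_record eta (j i n) \<omega>}
      = (\<Prod>i=1..s-1. 1 - exp (- (real (j i n) / real n) * y i))" for n
      using record_indices.cond_prob_gaps[OF rec, of s "\<lambda>i. y i / real n"] s y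
      by (simp add: less_imp_le)
    then show "(\<lambda>n. cond_prob_el M
              {\<omega> \<in> space M. \<forall>i\<in>{1..s-1}. eta (j (Suc i) n) \<omega> - eta (j i n) \<omega> \<le> y i / real n}
              {\<omega> \<in> space M. \<forall>i\<in>{1..s}. is_record eta (j i n) \<omega>})
        \<longlonglongrightarrow> (\<Prod>i=1..s-1. 1 - exp (- lam i * y i))"
      by (simp only:) (intro tendsto_intros j_lim, auto)
  next
    fix x y :: real
    assume xy: "x \<le> 0" "y > 0"
    \<comment> \<open>Here \<open>n = 0\<close> is excluded: both the positivity of
      \<open>y / n\<close> and \<open>Qfun_scale\<close> require \<open>n > 0\<close>. The limit is
      therefore transferred through an eventual equality.\<close>
    have "cond_prob_el M {\<omega> \<in> space M. eta (j 1 n) \<omega> \<le> x / real n \<and> eta (j 2 n) \<omega> - eta (j 1 n) \<omega> \<le> y / real n}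
        {\<omega> \<in> space M. is_record eta (j 1 n) \<omega> \<and> is_record eta (j 2 n) \<omega>}
      = Qfun (real (j 1 n) / real n) (real (j 2 n) / real n) x y" if "n > 0" for n
      using record_indices.cond_prob_two_records[OF rec, of "x / real n" "y / real n" n] xy that
      by (simp add: Qfun_scale divide_le_0_iff)
    then have "\<forall>\<^sub>F n in sequentially. Qfun (real (j 1 n) / real n) (real (j 2 n) / real n) x y
      = cond_prob_el M {\<omega> \<in> space M. eta (j 1 n) \<omega> \<le> x / real n \<and> eta (j 2 n) \<omega> - eta (j 1 n) \<omega> \<le> y / real n}
        {\<omega> \<in> space M. is_record eta (j 1 n) \<omega> \<and> is_record eta (j 2 n) \<omega>}"
      by (intro eventually_mono[OF eventually_gt_at_top[of 0]]) auto
    moreover have "(\<lambda>n. Qfun (real (j 1 n) / real n) (real (j 2 n) / real n) x y) \<longlonglongrightarrow> Qfun (lam 1) (lam 2) x y"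
      using lam_mono[of 1] by (intro tendsto_Qfun j_lim) (auto simp: numeral_2_eq_2)
    ultimately show "(\<lambda>n. cond_prob_el M
              {\<omega> \<in> space M. eta (j 1 n) \<omega> \<le> x / real n \<and>
                              eta (j 2 n) \<omega> - eta (j 1 n) \<omega> \<le> y / real n}
              {\<omega> \<in> space M. is_record eta (j 1 n) \<omega> \<and> is_record eta (j 2 n) \<omega>})
        \<longlonglongrightarrow> Qfun (lam 1) (lam 2) x y"
      by (rule Lim_transform_eventually[rotated])
  }
qed

end
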